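(* Let $(G,H,\alpha,\tau)$ and $(H,J,\alpha',\tau')$ be Lie crossed modules such that $\tau'(J)$ is closed in $H$ and $\tau\tau'(J)$ is closed in $G$, and let $\mathbf G$ be the categorical group associated with $(G,H,\alpha,\tau)$. Put $J_H=\{(\tau'(j),\tau\tau'(j')):j,j'\in J\}$, which is a normal subgroup of $H\rtimes_\alpha\tau(H)$. Let $\overline{\mathbf G}_\tau$ be given by $$\mathrm{Obj}(\overline{\mathbf G}_\tau)=\tau(H)/\tau\tau'(J),\qquad \mathrm{Mor}(\overline{\mathbf G}_\tau)=\bigl(H\rtimes_\alpha\tau(H)\bigr)/J_H,$$ with source, target and composition induced from $\mathbf G$ and with the quotient group structures on objects and morphisms. Then $\overline{\mathbf G}_\tau$ is a categorical group. Furthermore, let $\mathbf G_\tau$ be the subcategory of $\mathbf G$ whose object set is $\tau(H)$ and whose morphisms are the morphisms of $\mathbf G$ with source in $\tau(H)$. Then the quotient maps $g\mapsto g\,\tau\tau'(J)$ and $(h,g)\mapsto(h,g)J_H$ give a functor $q_\tau:\mathbf G_\tau\to\overline{\mathbf G}_\tau$ that is a homomorphism both on objects and on morphisms.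
   Context: A categorical group is a small category $\mathbf K$ with a functor $\mathbf K\times\mathbf K\to\mathbf K$ making both the object set and the morphism set groups (source and target are then homomorphisms). A crossed module $(G,H,\alpha,\tau)$ consists of groups $G,H$ and homomorphisms $\tau:H\to G$, $\alpha:G\to\mathrm{Aut}(H)$ with $\tau(\alpha_g(h))=g\tau(h)g^{-1}$ and $\alpha_{\tau(h)}(h')=hh'h^{-1}$. It is a Lie crossed module if $G,H$ are Lie groups and $\tau$ and $(h,g)\mapsto\alpha_g(h)$ are smooth. The associated categorical group $\mathbf G$ has $\mathrm{Obj}(\mathbf G)=G$, $\mathrm{Mor}(\mathbf G)=H\rtimes_\alpha G$ with product $(h_2,g_2)(h_1,g_1)=(h_2\alpha_{g_2}(h_1),g_2g_1)$, source $s(h,g)=g$, target $t(h,g)=\tau(h)g$, and composition $(h_2,g_2)\circ(h_1,g_1)=(h_2h_1,g_1)$ when $g_2=\tau(h_1)g_1$. $H\rtimes_\alpha\tau(H)$ is the subgroup of elements with second component in $\tau(H)$; the subgroup $\tau\tau'(J)$ is normal in $\tau(H)$. The induced composition of two cosets is defined when the target of the first equals the source of the second in $\tau(H)/\tau\tau'(J)$; it is then the coset of $f_2\circ f_1$ for any representatives $f_1,f_2$ composable in $\mathbf G$. *)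

theory Defs
  imports "HOL-Analysis.Analysis" "HOL-Algebra.Coset" "HOL-Algebra.Bij"
begin

section \<open>Smooth manifolds and Lie groups\<close>

text \<open>The set \<open>S\<close> is meant to be open and the domain finite-dimensional: existence and
  continuity of all iterated directional derivatives up to order \<open>k\<close>, together with
  differentiability at each stage, is then the usual notion of class \<open>C\<^sup>k\<close>.\<close>

primrec Ck_on ::
    "nat \<Rightarrow> 'e::real_normed_vector set \<Rightarrow> ('e \<Rightarrow> 'f::real_normed_vector) \<Rightarrow> bool" where
  "Ck_on 0 S f \<longleftrightarrow> continuous_on S f"
| "Ck_on (Suc k) S f \<longleftrightarrow>
     (\<forall>x\<in>S. f differentiable (at x)) \<and>
     (\<forall>v. Ck_on k S (\<lambda>x. frechet_derivative f (at x) v))"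

definition smooth_on ::
    "'e::real_normed_vector set \<Rightarrow> ('e \<Rightarrow> 'f::real_normed_vector) \<Rightarrow> bool" where
  "smooth_on S f \<longleftrightarrow> (\<forall>k. Ck_on k S f)"

type_synonym ('a, 'e) chart = "'a set \<times> ('a \<Rightarrow> 'e)"

text \<open>The model space is a finite-dimensional real normed space rather than a type of class
  \<open>euclidean_space\<close>, because the latter has dimension at least one, and manifolds of
  dimension zero (discrete Lie groups) must not be excluded.\<close>

definition smooth_manifold ::
    "'a topology \<Rightarrow> ('a, 'e::real_normed_vector) chart set \<Rightarrow> bool" where
  "smooth_manifold X A \<longleftrightarrow>
     (\<exists>B::'e set. finite B \<and> span B = UNIV) \<and>
     Hausdorff_space X \<and>
     (\<exists>\<B>. countable \<B> \<and> (\<forall>V\<in>\<B>. openin X V) \<and>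
        (\<forall>U x. openin X U \<and> x \<in> U \<longrightarrow> (\<exists>V\<in>\<B>. x \<in> V \<and> V \<subseteq> U))) \<and>
     (\<forall>(U, \<phi>)\<in>A. openin X U \<and> open (\<phi> ` U) \<and>
        homeomorphic_map (subtopology X U) (subtopology euclidean (\<phi> ` U)) \<phi>) \<and>
     topspace X = (\<Union>(U, \<phi>)\<in>A. U) \<and>
     (\<forall>(U, \<phi>)\<in>A. \<forall>(V, \<psi>)\<in>A. smooth_on (\<phi> ` (U \<inter> V)) (\<psi> \<circ> inv_into U \<phi>))"

definition smooth_map ::
    "'a topology \<Rightarrow> ('a, 'e::real_normed_vector) chart set \<Rightarrow>
     'b topology \<Rightarrow> ('b, 'f::real_normed_vector) chart set \<Rightarrow> ('a \<Rightarrow> 'b) \<Rightarrow> bool" where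
  "smooth_map X A Y B f \<longleftrightarrow>
     continuous_map X Y f \<and>
     (\<forall>(U, \<phi>)\<in>A. \<forall>(V, \<psi>)\<in>B.
        smooth_on (\<phi> ` (U \<inter> f -` V)) (\<psi> \<circ> f \<circ> inv_into U \<phi>))"

definition prod_atlas ::
    "('a, 'e) chart set \<Rightarrow> ('b, 'f) chart set \<Rightarrow> ('a \<times> 'b, 'e \<times> 'f) chart set" where
  "prod_atlas A B = {(U \<times> V, map_prod \<phi> \<psi>) | U \<phi> V \<psi>. (U, \<phi>) \<in> A \<and> (V, \<psi>) \<in> B}"

record ('a, 'e) lie_data = "'a monoid" +
  Top :: "'a topology"
  Atlas :: "('a, 'e) chart set"

definition lie_group :: "('a, 'e::real_normed_vector) lie_data \<Rightarrow> bool" where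
  "lie_group G \<longleftrightarrow>
     group G \<and>
     topspace (Top G) = carrier G \<and>
     smooth_manifold (Top G) (Atlas G) \<and>
     smooth_map (prod_topology (Top G) (Top G)) (prod_atlas (Atlas G) (Atlas G))
       (Top G) (Atlas G) (\<lambda>(x, y). x \<otimes>\<^bsub>G\<^esub> y) \<and>
     smooth_map (Top G) (Atlas G) (Top G) (Atlas G) (\<lambda>x. inv\<^bsub>G\<^esub> x)"


section \<open>Crossed modules\<close>

definition crossed_module ::
    "('g, 'x) monoid_scheme \<Rightarrow> ('h, 'y) monoid_scheme \<Rightarrow> ('g \<Rightarrow> 'h \<Rightarrow> 'h) \<Rightarrow> ('h \<Rightarrow> 'g) \<Rightarrow> bool" where
  "crossed_module G H \<alpha> \<tau> \<longleftrightarrow>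
     group G \<and> group H \<and> \<tau> \<in> hom H G \<and> \<alpha> \<in> hom G (AutoGroup H) \<and>
     (\<forall>g\<in>carrier G. \<forall>h\<in>carrier H. \<tau> (\<alpha> g h) = g \<otimes>\<^bsub>G\<^esub> \<tau> h \<otimes>\<^bsub>G\<^esub> inv\<^bsub>G\<^esub> g) \<and>
     (\<forall>h\<in>carrier H. \<forall>h'\<in>carrier H. \<alpha> (\<tau> h) h' = h \<otimes>\<^bsub>H\<^esub> h' \<otimes>\<^bsub>H\<^esub> inv\<^bsub>H\<^esub> h)"

definition lie_crossed_module ::
    "('g, 'e::real_normed_vector) lie_data \<Rightarrow> ('h, 'f::real_normed_vector) lie_data \<Rightarrow>
     ('g \<Rightarrow> 'h \<Rightarrow> 'h) \<Rightarrow> ('h \<Rightarrow> 'g) \<Rightarrow> bool" where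
  "lie_crossed_module G H \<alpha> \<tau> \<longleftrightarrow>
     lie_group G \<and> lie_group H \<and> crossed_module G H \<alpha> \<tau> \<and>
     smooth_map (Top H) (Atlas H) (Top G) (Atlas G) \<tau> \<and>
     smooth_map (prod_topology (Top H) (Top G)) (prod_atlas (Atlas H) (Atlas G))
       (Top H) (Atlas H) (\<lambda>(h, g). \<alpha> g h)"

definition semidirect ::
    "('h, 'y) monoid_scheme \<Rightarrow> ('g, 'x) monoid_scheme \<Rightarrow> ('g \<Rightarrow> 'h \<Rightarrow> 'h) \<Rightarrow> ('h \<times> 'g) monoid" where
  "semidirect H G \<alpha> =
     \<lparr>carrier = carrier H \<times> carrier G,
      mult = (\<lambda>(h2, g2) (h1, g1). (h2 \<otimes>\<^bsub>H\<^esub> \<alpha> g2 h1, g2 \<otimes>\<^bsub>G\<^esub> g1)),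
      one = (\<one>\<^bsub>H\<^esub>, \<one>\<^bsub>G\<^esub>)\<rparr>"


section \<open>Small categories and categorical groups\<close>

text \<open>\<open>Comp K g f\<close> is the composite of \<open>f\<close> followed by \<open>g\<close>; its value is relevant only if
  \<open>Tgt K f = Src K g\<close>.\<close>

record ('o, 'm) cat_data =
  Obj :: "'o set"
  Mor :: "'m set"
  Src :: "'m \<Rightarrow> 'o"
  Tgt :: "'m \<Rightarrow> 'o"
  Comp :: "'m \<Rightarrow> 'm \<Rightarrow> 'm"

definition is_identity :: "('o, 'm) cat_data \<Rightarrow> 'o \<Rightarrow> 'm \<Rightarrow> bool" where
  "is_identity K a i \<longleftrightarrow>
     a \<in> Obj K \<and> i \<in> Mor K \<and> Src K i = a \<and> Tgt K i = a \<and>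
     (\<forall>f\<in>Mor K. Tgt K f = a \<longrightarrow> Comp K i f = f) \<and>
     (\<forall>f\<in>Mor K. Src K f = a \<longrightarrow> Comp K f i = f)"

definition small_category :: "('o, 'm) cat_data \<Rightarrow> bool" where
  "small_category K \<longleftrightarrow>
     (\<forall>f\<in>Mor K. Src K f \<in> Obj K \<and> Tgt K f \<in> Obj K) \<and>
     (\<forall>f\<in>Mor K. \<forall>g\<in>Mor K. Tgt K f = Src K g \<longrightarrow>
        Comp K g f \<in> Mor K \<and> Src K (Comp K g f) = Src K f \<and> Tgt K (Comp K g f) = Tgt K g) \<and>
     (\<forall>f\<in>Mor K. \<forall>g\<in>Mor K. \<forall>h\<in>Mor K. Tgt K f = Src K g \<and> Tgt K g = Src K h \<longrightarrow>
        Comp K h (Comp K g f) = Comp K (Comp K h g) f) \<and>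
     (\<forall>a\<in>Obj K. \<exists>i. is_identity K a i)"

definition is_functor ::
    "('o, 'm) cat_data \<Rightarrow> ('p, 'n) cat_data \<Rightarrow> ('o \<Rightarrow> 'p) \<Rightarrow> ('m \<Rightarrow> 'n) \<Rightarrow> bool" where
  "is_functor K L Fo Fm \<longleftrightarrow>
     small_category K \<and> small_category L \<and>
     (\<forall>a\<in>Obj K. Fo a \<in> Obj L) \<and>
     (\<forall>f\<in>Mor K. Fm f \<in> Mor L \<and> Src L (Fm f) = Fo (Src K f) \<and> Tgt L (Fm f) = Fo (Tgt K f)) \<and>
     (\<forall>a i. is_identity K a i \<longrightarrow> is_identity L (Fo a) (Fm i)) \<and>
     (\<forall>f\<in>Mor K. \<forall>g\<in>Mor K. Tgt K f = Src K g \<longrightarrow> Fm (Comp K g f) = Comp L (Fm g) (Fm f))"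

definition subcategory :: "('o, 'm) cat_data \<Rightarrow> ('o, 'm) cat_data \<Rightarrow> bool" where
  "subcategory S K \<longleftrightarrow> Obj S \<subseteq> Obj K \<and> Mor S \<subseteq> Mor K \<and> is_functor S K (\<lambda>a. a) (\<lambda>f. f)"

definition prod_category ::
    "('o, 'm) cat_data \<Rightarrow> ('p, 'n) cat_data \<Rightarrow> ('o \<times> 'p, 'm \<times> 'n) cat_data" where
  "prod_category K L =
     \<lparr>Obj = Obj K \<times> Obj L, Mor = Mor K \<times> Mor L,
      Src = map_prod (Src K) (Src L), Tgt = map_prod (Tgt K) (Tgt L),
      Comp = (\<lambda>(g, g') (f, f'). (Comp K g f, Comp L g' f'))\<rparr>"

definition categorical_group ::
    "('o, 'm) cat_data \<Rightarrow> 'o monoid \<Rightarrow> 'm monoid \<Rightarrow> bool" where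
  "categorical_group K GO GM \<longleftrightarrow>
     small_category K \<and>
     carrier GO = Obj K \<and> group GO \<and>
     carrier GM = Mor K \<and> group GM \<and>
     is_functor (prod_category K K) K (\<lambda>(a, b). a \<otimes>\<^bsub>GO\<^esub> b) (\<lambda>(f, g). f \<otimes>\<^bsub>GM\<^esub> g)"


section \<open>The category of a crossed module and its quotient\<close>

definition assoc_category ::
    "('g, 'x) monoid_scheme \<Rightarrow> ('h, 'y) monoid_scheme \<Rightarrow> ('g \<Rightarrow> 'h \<Rightarrow> 'h) \<Rightarrow> ('h \<Rightarrow> 'g) \<Rightarrow>
     ('g, 'h \<times> 'g) cat_data" where
  "assoc_category G H \<alpha> \<tau> =
     \<lparr>Obj = carrier G, Mor = carrier (semidirect H G \<alpha>),
      Src = (\<lambda>(h, g). g), Tgt = (\<lambda>(h, g). \<tau> h \<otimes>\<^bsub>G\<^esub> g),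
      Comp = (\<lambda>(h2, g2) (h1, g1). (h2 \<otimes>\<^bsub>H\<^esub> h1, g1))\<rparr>"

definition tau_category ::
    "('g, 'x) monoid_scheme \<Rightarrow> ('h, 'y) monoid_scheme \<Rightarrow> ('g \<Rightarrow> 'h \<Rightarrow> 'h) \<Rightarrow> ('h \<Rightarrow> 'g) \<Rightarrow>
     ('g, 'h \<times> 'g) cat_data" where
  "tau_category G H \<alpha> \<tau> =
     (assoc_category G H \<alpha> \<tau>)
       \<lparr>Obj := \<tau> ` carrier H,
        Mor := {f \<in> Mor (assoc_category G H \<alpha> \<tau>).
                  Src (assoc_category G H \<alpha> \<tau>) f \<in> \<tau> ` carrier H}\<rparr>"

text \<open>The groups \<open>\<tau>(H)\<close> and \<open>H \<rtimes> \<tau>(H)\<close>.\<close>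

definition tau_obj_group ::
    "('g, 'x) monoid_scheme \<Rightarrow> ('h, 'y) monoid_scheme \<Rightarrow> ('h \<Rightarrow> 'g) \<Rightarrow> ('g, 'x) monoid_scheme" where
  "tau_obj_group G H \<tau> = G\<lparr>carrier := \<tau> ` carrier H\<rparr>"

definition tau_mor_group ::
    "('g, 'x) monoid_scheme \<Rightarrow> ('h, 'y) monoid_scheme \<Rightarrow> ('g \<Rightarrow> 'h \<Rightarrow> 'h) \<Rightarrow> ('h \<Rightarrow> 'g) \<Rightarrow>
     ('h \<times> 'g) monoid" where
  "tau_mor_group G H \<alpha> \<tau> =
     (semidirect H G \<alpha>)
       \<lparr>carrier := {f \<in> carrier (semidirect H G \<alpha>). snd f \<in> \<tau> ` carrier H}\<rparr>"

definition J_sub :: "('j, 'z) monoid_scheme \<Rightarrow> ('h \<Rightarrow> 'g) \<Rightarrow> ('j \<Rightarrow> 'h) \<Rightarrow> 'g set" where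
  "J_sub J \<tau> \<tau>' = \<tau> ` \<tau>' ` carrier J"

definition J_H :: "('j, 'z) monoid_scheme \<Rightarrow> ('h \<Rightarrow> 'g) \<Rightarrow> ('j \<Rightarrow> 'h) \<Rightarrow> ('h \<times> 'g) set" where
  "J_H J \<tau> \<tau>' = {(\<tau>' j, \<tau> (\<tau>' j')) | j j'. j \<in> carrier J \<and> j' \<in> carrier J}"

definition quot_obj_group where
  "quot_obj_group G H J \<tau> \<tau>' = tau_obj_group G H \<tau> Mod J_sub J \<tau> \<tau>'"

definition quot_mor_group where
  "quot_mor_group G H J \<alpha> \<tau> \<tau>' = tau_mor_group G H \<alpha> \<tau> Mod J_H J \<tau> \<tau>'"

definition obj_coset where
  "obj_coset G H J \<tau> \<tau>' g = g <#\<^bsub>tau_obj_group G H \<tau>\<^esub> J_sub J \<tau> \<tau>'"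

definition mor_coset where
  "mor_coset G H J \<alpha> \<tau> \<tau>' f = f <#\<^bsub>tau_mor_group G H \<alpha> \<tau>\<^esub> J_H J \<tau> \<tau>'"

text \<open>Each induced operation is the union of the cosets obtained from all admissible choices of
  representatives.  Such a union is again a single coset exactly if there is an admissible choice
  and all choices give the same coset, so the operation being well defined is part of the claim
  that the data below form a category.\<close>

definition quot_category ::
    "('g, 'x) monoid_scheme \<Rightarrow> ('h, 'y) monoid_scheme \<Rightarrow> ('j, 'z) monoid_scheme \<Rightarrow>
     ('g \<Rightarrow> 'h \<Rightarrow> 'h) \<Rightarrow> ('h \<Rightarrow> 'g) \<Rightarrow> ('j \<Rightarrow> 'h) \<Rightarrow> ('g set, ('h \<times> 'g) set) cat_data" where
  "quot_category G H J \<alpha> \<tau> \<tau>' = (let K = tau_category G H \<alpha> \<tau> in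
     \<lparr>Obj = carrier (quot_obj_group G H J \<tau> \<tau>'),
      Mor = carrier (quot_mor_group G H J \<alpha> \<tau> \<tau>'),
      Src = (\<lambda>A. \<Union>f\<in>A. obj_coset G H J \<tau> \<tau>' (Src K f)),
      Tgt = (\<lambda>A. \<Union>f\<in>A. obj_coset G H J \<tau> \<tau>' (Tgt K f)),
      Comp = (\<lambda>B A. \<Union>{mor_coset G H J \<alpha> \<tau> \<tau>' (Comp K f2 f1) | f1 f2.
                         f1 \<in> A \<and> f2 \<in> B \<and> Tgt K f1 = Src K f2})\<rparr>)"

end

(* Write N for \<tau>'(J), which is normal in H, and M for \<tau>(N).  An element of \<tau>(H) acts on H by
   an inner automorphism and therefore maps N onto itself, so the coset of (h, g) modulo
   J_H = N x M is hN x gM.  The induced operations are thus computed componentwise, and morphisms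
   that become composable modulo M have representatives that are composable on the nose: the
   source of (h, g) can be moved within gM without leaving the coset.  All identities, including
   the exchange law, then descend from the categorical group of the restricted crossed module. *)

theory Submission
  imports Defs
begin

section \<open>Small categories and their quotients\<close>

text \<open>The category records carry no map assigning identities, only their existence is
  required. Uniqueness is what later lets an abstract identity be replaced by an explicit
  one.\<close>

lemma is_identity_unique:
  assumes "is_identity K a i" "is_identity K a j"
  shows "i = j"
  using assms unfolding is_identity_def by metis

lemma small_category_prod:
  assumes "small_category K" "small_category L"
  shows "small_category (prod_category K L)"
  unfolding small_category_def
proof (intro conjI ballI impI)
  fix p assume "p \<in> Obj (prod_category K L)"
  then obtain a b where p: "p = (a, b)" "a \<in> Obj K" "b \<in> Obj L"
    by (auto simp: prod_category_def)
  then obtain i j where "is_identity K a i" "is_identity L b j"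
    using assms unfolding small_category_def by meson
  then have "is_identity (prod_category K L) p (i, j)"
    using p by (auto simp: is_identity_def prod_category_def)
  then show "\<exists>i. is_identity (prod_category K L) p i" ..
qed (use assms in \<open>auto simp: small_category_def prod_category_def\<close>)

text \<open>To test \<open>i\<close> against a morphism of \<open>K\<close>, a partner in
  \<open>L\<close> with matching endpoint \<open>b\<close> is required; \<open>j\<close> itself
  serves, and \<open>i\<close> does the same for \<open>L\<close>.\<close>

lemma is_identity_prodD:
  assumes "is_identity (prod_category K L) (a, b) (i, j)"
  shows "is_identity K a i" "is_identity L b j"
proof -
  from assms have mem: "a \<in> Obj K" "b \<in> Obj L" "i \<in> Mor K" "j \<in> Mor L"
    "Src K i = a" "Tgt K i = a" "Src L j = b" "Tgt L j = b"
    by (auto simp: is_identity_def prod_category_def)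
  from assms have l: "Comp K i f = f \<and> Comp L j g = g"
    if "f \<in> Mor K" "g \<in> Mor L" "Tgt K f = a" "Tgt L g = b" for f g
    using that by (auto simp: is_identity_def prod_category_def)
  from assms have r: "Comp K f i = f \<and> Comp L g j = g"
    if "f \<in> Mor K" "g \<in> Mor L" "Src K f = a" "Src L g = b" for f g
    using that by (auto simp: is_identity_def prod_category_def)
  show "is_identity K a i" "is_identity L b j"
    using mem l r unfolding is_identity_def by blast+
qed

lemma is_identity_prodI:
  assumes "is_identity K a i" "is_identity L b j"
  shows "is_identity (prod_category K L) (a, b) (i, j)"
  using assms by (auto simp: is_identity_def prod_category_def)

section \<open>Descent of categorical structure to a quotient\<close>

text \<open>Morphisms that become composable in the quotient are required to have composable
  representatives, where either of the two may be the one that is kept.\<close>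

locale category_quotient =
  fixes K :: "('o, 'm) cat_data" and L :: "('p, 'n) cat_data"
    and Fo :: "'o \<Rightarrow> 'p" and Fm :: "'m \<Rightarrow> 'n"
  assumes small: "small_category K"
    and Obj_quot: "Obj L = Fo ` Obj K"
    and Mor_quot: "Mor L = Fm ` Mor K"
    and Src_quot: "f \<in> Mor K \<Longrightarrow> Src L (Fm f) = Fo (Src K f)"
    and Tgt_quot: "f \<in> Mor K \<Longrightarrow> Tgt L (Fm f) = Fo (Tgt K f)"
    and Comp_quot: "\<lbrakk>f \<in> Mor K; g \<in> Mor K; Tgt K f = Src K g\<rbrakk> \<Longrightarrow>
          Comp L (Fm g) (Fm f) = Fm (Comp K g f)"
    and lift_left: "\<lbrakk>a \<in> Obj K; g \<in> Mor K; Fo a = Fo (Src K g)\<rbrakk> \<Longrightarrow>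
          \<exists>g'\<in>Mor K. Fm g' = Fm g \<and> Src K g' = a"
    and lift_right: "\<lbrakk>a \<in> Obj K; f \<in> Mor K; Fo a = Fo (Tgt K f)\<rbrakk> \<Longrightarrow>
          \<exists>f'\<in>Mor K. Fm f' = Fm f \<and> Tgt K f' = a"
begin

lemma Src_closed: "f \<in> Mor K \<Longrightarrow> Src K f \<in> Obj K"
  and Tgt_closed: "f \<in> Mor K \<Longrightarrow> Tgt K f \<in> Obj K"
  and Comp_closed: "\<lbrakk>f \<in> Mor K; g \<in> Mor K; Tgt K f = Src K g\<rbrakk> \<Longrightarrow> Comp K g f \<in> Mor K"
  and Src_Comp: "\<lbrakk>f \<in> Mor K; g \<in> Mor K; Tgt K f = Src K g\<rbrakk> \<Longrightarrow> Src K (Comp K g f) = Src K f"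
  and Tgt_Comp: "\<lbrakk>f \<in> Mor K; g \<in> Mor K; Tgt K f = Src K g\<rbrakk> \<Longrightarrow> Tgt K (Comp K g f) = Tgt K g"
  using small unfolding small_category_def by auto

lemma lift_composable:
  assumes "f \<in> Mor L" "g \<in> Mor L" "Tgt L f = Src L g"
  obtains f' g' where "f' \<in> Mor K" "g' \<in> Mor K" "f = Fm f'" "g = Fm g'" "Tgt K f' = Src K g'"
proof -
  from assms obtain f' g' where *: "f' \<in> Mor K" "g' \<in> Mor K" "f = Fm f'" "g = Fm g'"
    by (auto simp: Mor_quot)
  then have "Fo (Tgt K f') = Fo (Src K g')"
    using assms Src_quot Tgt_quot by metis
  \<comment> \<open>The representative of \<open>f\<close> is kept; only that of \<open>g\<close> is
    exchanged, for one starting exactly where \<open>f'\<close> ends.\<close>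
  then obtain g'' where "g'' \<in> Mor K" "Fm g'' = Fm g'" "Src K g'' = Tgt K f'"
    using lift_left[OF Tgt_closed] * by metis
  with * that show thesis by metis
qed

text \<open>A representative of a morphism with endpoint \<open>Fo a\<close> has an endpoint that
  only maps to \<open>Fo a\<close>. Lifting moves that endpoint to \<open>a\<close> itself, where
  the identity law of \<open>K\<close> applies; the law on the left moves the target
  (\<open>lift_right\<close>), the law on the right the source (\<open>lift_left\<close>).\<close>

lemma is_identity_quot:
  assumes "is_identity K a i"
  shows "is_identity L (Fo a) (Fm i)"
  unfolding is_identity_def
proof (intro conjI ballI impI)
  have i: "a \<in> Obj K" "i \<in> Mor K" "Src K i = a" "Tgt K i = a"
    and il: "\<And>f. f \<in> Mor K \<Longrightarrow> Tgt K f = a \<Longrightarrow> Comp K i f = f"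
    and ir: "\<And>f. f \<in> Mor K \<Longrightarrow> Src K f = a \<Longrightarrow> Comp K f i = f"
    using assms unfolding is_identity_def by auto
  show "Fo a \<in> Obj L" "Fm i \<in> Mor L" "Src L (Fm i) = Fo a" "Tgt L (Fm i) = Fo a"
    using i by (auto simp: Obj_quot Mor_quot Src_quot Tgt_quot)
  fix f assume f: "f \<in> Mor L"
  then obtain f0 where f0: "f0 \<in> Mor K" "f = Fm f0"
    by (auto simp: Mor_quot)
  show "Comp L (Fm i) f = f" if tgt: "Tgt L f = Fo a"
  proof -
    obtain f' where f': "f' \<in> Mor K" "Fm f' = f" "Tgt K f' = a"
      using lift_right[OF i(1) f0(1)] tgt f0 by (auto simp: Tgt_quot)
    then show ?thesis
      using Comp_quot[OF f'(1) i(2)] i il by metis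
  qed
  show "Comp L f (Fm i) = f" if src: "Src L f = Fo a"
  proof -
    obtain f' where f': "f' \<in> Mor K" "Fm f' = f" "Src K f' = a"
      using lift_left[OF i(1) f0(1)] src f0 by (auto simp: Src_quot)
    then show ?thesis
      using Comp_quot[OF i(2) f'(1)] i ir by metis
  qed
qed

lemma small_category_quot: "small_category L"
  unfolding small_category_def
proof (intro conjI ballI impI)
  fix f assume "f \<in> Mor L"
  then show "Src L f \<in> Obj L" "Tgt L f \<in> Obj L"
    by (auto simp: Mor_quot Obj_quot Src_quot Tgt_quot Src_closed Tgt_closed)
next
  fix f g assume "f \<in> Mor L" "g \<in> Mor L" "Tgt L f = Src L g"
  then obtain f' g' where *: "f' \<in> Mor K" "g' \<in> Mor K" "f = Fm f'" "g = Fm g'" "Tgt K f' = Src K g'"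
    by (rule lift_composable)
  then show "Comp L g f \<in> Mor L" "Src L (Comp L g f) = Src L f" "Tgt L (Comp L g f) = Tgt L g"
    by (auto simp: Comp_quot Mor_quot Comp_closed Src_quot Tgt_quot Src_Comp Tgt_Comp)
next
  fix f g h assume "f \<in> Mor L" "g \<in> Mor L" and h: "h \<in> Mor L"
    and "Tgt L f = Src L g \<and> Tgt L g = Src L h"
  then obtain f' g' where *: "f' \<in> Mor K" "g' \<in> Mor K" "f = Fm f'" "g = Fm g'" "Tgt K f' = Src K g'"
      and gh: "Tgt L g = Src L h"
    using lift_composable[of f g] by blast
  obtain h0 where h0: "h0 \<in> Mor K" "h = Fm h0"
    using h by (auto simp: Mor_quot)
  \<comment> \<open>With the pair \<open>f'\<close>, \<open>g'\<close> fixed, a representative of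
    \<open>h\<close> starting exactly at the target of \<open>g'\<close> makes the whole triple
    composable in \<open>K\<close>.\<close>
  obtain h' where h': "h' \<in> Mor K" "h = Fm h'" "Src K h' = Tgt K g'"
    using lift_left[OF Tgt_closed h0(1), of g'] gh * h0 by (auto simp: Src_quot Tgt_quot)
  have "Comp K h' (Comp K g' f') = Comp K (Comp K h' g') f'"
    using small * h' unfolding small_category_def by metis
  then show "Comp L h (Comp L g f) = Comp L (Comp L h g) f"
    using * h' by (simp add: Comp_quot Comp_closed Src_Comp Tgt_Comp)
next
  fix p assume "p \<in> Obj L"
  then obtain a where a: "a \<in> Obj K" "p = Fo a" by (auto simp: Obj_quot)
  then obtain i where "is_identity K a i"
    using small unfolding small_category_def by meson
  then show "\<exists>i. is_identity L p i"
    using is_identity_quot a by blast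
qed

lemma is_functor_quot: "is_functor K L Fo Fm"
  unfolding is_functor_def
  using small small_category_quot is_identity_quot
  by (auto simp: Obj_quot Mor_quot Src_quot Tgt_quot Comp_quot)

text \<open>The group laws on \<open>L\<close> come from \<open>GO\<close> and \<open>GM\<close>.
  What has to descend from \<open>K\<close> is the functoriality of the multiplication, and this is
  checked on representatives because \<open>Fo\<close> and \<open>Fm\<close> carry \<open>mo\<close>
  and \<open>mm\<close> to the group products.\<close>

lemma categorical_group_quot:
  fixes GO :: "'p monoid" and GM :: "'n monoid"
  assumes tensor: "is_functor (prod_category K K) K (\<lambda>(a, b). mo a b) (\<lambda>(f, g). mm f g)"
    and GO: "group GO" "carrier GO = Obj L" and GM: "group GM" "carrier GM = Mor L"
    and hom_o: "\<And>a b. \<lbrakk>a \<in> Obj K; b \<in> Obj K\<rbrakk> \<Longrightarrow> Fo (mo a b) = Fo a \<otimes>\<^bsub>GO\<^esub> Fo b"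
    and hom_m: "\<And>f g. \<lbrakk>f \<in> Mor K; g \<in> Mor K\<rbrakk> \<Longrightarrow> Fm (mm f g) = Fm f \<otimes>\<^bsub>GM\<^esub> Fm g"
  shows "categorical_group L GO GM"
proof -
  have mo: "mo a b \<in> Obj K" if "a \<in> Obj K" "b \<in> Obj K" for a b
    using tensor that unfolding is_functor_def by (auto simp: prod_category_def)
  have mm: "mm f g \<in> Mor K" "Src K (mm f g) = mo (Src K f) (Src K g)"
    "Tgt K (mm f g) = mo (Tgt K f) (Tgt K g)" if "f \<in> Mor K" "g \<in> Mor K" for f g
    using tensor that unfolding is_functor_def by (auto simp: prod_category_def)
  have mm_id: "is_identity K (mo a b) (mm i j)" if "is_identity K a i" "is_identity K b j" for a b i j
  proof -
    have "\<forall>p q. is_identity (prod_category K K) p q \<longrightarrow>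
        is_identity K (case p of (a, b) \<Rightarrow> mo a b) (case q of (f, g) \<Rightarrow> mm f g)"
      using tensor unfolding is_functor_def by blast
    from this[rule_format, OF is_identity_prodI[OF that]] show ?thesis by simp
  qed
  have mm_Comp: "mm (Comp K g f) (Comp K g' f') = Comp K (mm g g') (mm f f')"
    if "f \<in> Mor K" "f' \<in> Mor K" "g \<in> Mor K" "g' \<in> Mor K" "Tgt K f = Src K g" "Tgt K f' = Src K g'"
    for f f' g g'
    using tensor that unfolding is_functor_def by (auto simp: prod_category_def)
  \<comment> \<open>An identity of \<open>L\<close> at \<open>Fo a'\<close> must equal the image of
    the identity at \<open>a'\<close>, since that image is also an identity there.\<close>
  have lift_id: "\<exists>a' i'. is_identity K a' i' \<and> a = Fo a' \<and> i = Fm i'" if i: "is_identity L a i" for a i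
  proof -
    obtain a' where a': "a' \<in> Obj K" "a = Fo a'"
      using i by (auto simp: is_identity_def Obj_quot)
    then obtain i' where "is_identity K a' i'"
      using small unfolding small_category_def by meson
    with a' show ?thesis
      using is_identity_quot is_identity_unique[OF i] by blast
  qed
  have "is_functor (prod_category L L) L (\<lambda>(a, b). a \<otimes>\<^bsub>GO\<^esub> b) (\<lambda>(f, g). f \<otimes>\<^bsub>GM\<^esub> g)"
    unfolding is_functor_def
  proof (intro conjI ballI impI allI)
    show "small_category (prod_category L L)" "small_category L"
      using small_category_prod small_category_quot by blast+
  next
    fix p assume "p \<in> Obj (prod_category L L)"
    then obtain a b where "a \<in> Obj K" "b \<in> Obj K" "p = (Fo a, Fo b)"
      by (auto simp: prod_category_def Obj_quot)
    then show "(case p of (a, b) \<Rightarrow> a \<otimes>\<^bsub>GO\<^esub> b) \<in> Obj L"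
      by (auto simp: Obj_quot mo simp flip: hom_o)
  next
    fix p assume "p \<in> Mor (prod_category L L)"
    then obtain f g where *: "f \<in> Mor K" "g \<in> Mor K" "p = (Fm f, Fm g)"
      by (auto simp: prod_category_def Mor_quot)
    then have m: "(case p of (f, g) \<Rightarrow> f \<otimes>\<^bsub>GM\<^esub> g) = Fm (mm f g)"
      by (simp add: hom_m)
    show "(case p of (f, g) \<Rightarrow> f \<otimes>\<^bsub>GM\<^esub> g) \<in> Mor L"
      and "Src L (case p of (f, g) \<Rightarrow> f \<otimes>\<^bsub>GM\<^esub> g) = (case Src (prod_category L L) p of (a, b) \<Rightarrow> a \<otimes>\<^bsub>GO\<^esub> b)"
      and "Tgt L (case p of (f, g) \<Rightarrow> f \<otimes>\<^bsub>GM\<^esub> g) = (case Tgt (prod_category L L) p of (a, b) \<Rightarrow> a \<otimes>\<^bsub>GO\<^esub> b)"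
      unfolding m using *
      by (simp_all add: prod_category_def Mor_quot mm Src_quot Tgt_quot hom_o Src_closed Tgt_closed)
  next
    fix p q assume "is_identity (prod_category L L) p q"
    then obtain a b i j where p: "p = (a, b)" and q: "q = (i, j)"
      and "is_identity L a i" "is_identity L b j"
      using is_identity_prodD by (metis surj_pair)
    then obtain a' b' i' j' where *: "is_identity K a' i'" "is_identity K b' j'"
      "a = Fo a'" "i = Fm i'" "b = Fo b'" "j = Fm j'"
      using lift_id by metis
    then have mem: "a' \<in> Obj K" "b' \<in> Obj K" "i' \<in> Mor K" "j' \<in> Mor K"
      by (auto simp: is_identity_def)
    show "is_identity L (case p of (a, b) \<Rightarrow> a \<otimes>\<^bsub>GO\<^esub> b) (case q of (f, g) \<Rightarrow> f \<otimes>\<^bsub>GM\<^esub> g)"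
      using is_identity_quot[OF mm_id[OF *(1,2)]] p q * mem by (simp add: hom_o hom_m)
  next
    fix p q assume pq: "p \<in> Mor (prod_category L L)" "q \<in> Mor (prod_category L L)"
      "Tgt (prod_category L L) p = Src (prod_category L L) q"
    obtain f f' g g' where p: "p = (f, f')" and q: "q = (g, g')" by (metis surj_pair)
    have "f \<in> Mor L" "g \<in> Mor L" "Tgt L f = Src L g"
      using pq p q by (auto simp: prod_category_def)
    then obtain f1 g1 where 1: "f1 \<in> Mor K" "g1 \<in> Mor K" "f = Fm f1" "g = Fm g1" "Tgt K f1 = Src K g1"
      by (rule lift_composable)
    have "f' \<in> Mor L" "g' \<in> Mor L" "Tgt L f' = Src L g'"
      using pq p q by (auto simp: prod_category_def)
    then obtain f2 g2 where 2: "f2 \<in> Mor K" "g2 \<in> Mor K" "f' = Fm f2" "g' = Fm g2" "Tgt K f2 = Src K g2"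
      by (rule lift_composable)
    \<comment> \<open>The two composable pairs may be lifted independently of each other; the
      exchange law of \<open>K\<close> then applies to the four representatives.\<close>
    have "Comp L g f \<otimes>\<^bsub>GM\<^esub> Comp L g' f' = Fm (mm (Comp K g1 f1) (Comp K g2 f2))"
      using 1 2 by (simp add: Comp_quot hom_m Comp_closed)
    also have "\<dots> = Fm (Comp K (mm g1 g2) (mm f1 f2))"
      using 1 2 by (simp add: mm_Comp)
    also have "\<dots> = Comp L (g \<otimes>\<^bsub>GM\<^esub> g') (f \<otimes>\<^bsub>GM\<^esub> f')"
      using 1 2 by (simp add: mm Comp_quot flip: hom_m)
    finally show "(case Comp (prod_category L L) q p of (f, g) \<Rightarrow> f \<otimes>\<^bsub>GM\<^esub> g)
        = Comp L (case q of (f, g) \<Rightarrow> f \<otimes>\<^bsub>GM\<^esub> g) (case p of (f, g) \<Rightarrow> f \<otimes>\<^bsub>GM\<^esub> g)"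
      by (simp add: p q prod_category_def)
  qed
  then show ?thesis
    using GO GM small_category_quot unfolding categorical_group_def by blast
qed

end


section \<open>The categorical group of a crossed module\<close>

locale crossed_mod =
  fixes G :: "('g, 'x) monoid_scheme" and H :: "('h, 'y) monoid_scheme"
    and \<alpha> :: "'g \<Rightarrow> 'h \<Rightarrow> 'h" and \<tau> :: "'h \<Rightarrow> 'g"
  assumes crossed: "crossed_module G H \<alpha> \<tau>"
begin

sublocale G: group G + H: group H + \<tau>: group_hom H G \<tau>
  using crossed unfolding crossed_module_def
  by (auto simp: group_hom_def group_hom_axioms_def)

lemma peiffer:
  "\<lbrakk>h \<in> carrier H; h' \<in> carrier H\<rbrakk> \<Longrightarrow> \<alpha> (\<tau> h) h' = h \<otimes>\<^bsub>H\<^esub> h' \<otimes>\<^bsub>H\<^esub> inv\<^bsub>H\<^esub> h"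
  and equivariant:
  "\<lbrakk>g \<in> carrier G; h \<in> carrier H\<rbrakk> \<Longrightarrow> \<tau> (\<alpha> g h) = g \<otimes>\<^bsub>G\<^esub> \<tau> h \<otimes>\<^bsub>G\<^esub> inv\<^bsub>G\<^esub> g"
  using crossed unfolding crossed_module_def by auto

lemma action_auto: "g \<in> carrier G \<Longrightarrow> \<alpha> g \<in> auto H"
  using crossed unfolding crossed_module_def AutoGroup_def by (auto simp: hom_def)

lemma action_closed [simp]: "\<lbrakk>g \<in> carrier G; h \<in> carrier H\<rbrakk> \<Longrightarrow> \<alpha> g h \<in> carrier H"
  and action_mult [simp]: "\<lbrakk>g \<in> carrier G; h \<in> carrier H; h' \<in> carrier H\<rbrakk> \<Longrightarrow>
    \<alpha> g (h \<otimes>\<^bsub>H\<^esub> h') = \<alpha> g h \<otimes>\<^bsub>H\<^esub> \<alpha> g h'"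
  using action_auto unfolding auto_def hom_def by auto

text \<open>The product of \<open>AutoGroup H\<close> is \<open>compose (carrier H)\<close>, which
  is \<open>undefined\<close> off the carrier; the action law is therefore stated pointwise on
  \<open>carrier H\<close>.\<close>

lemma mult_action [simp]:
  assumes "g \<in> carrier G" "g' \<in> carrier G" "h \<in> carrier H"
  shows "\<alpha> (g \<otimes>\<^bsub>G\<^esub> g') h = \<alpha> g (\<alpha> g' h)"
proof -
  have "\<alpha> (g \<otimes>\<^bsub>G\<^esub> g') = \<alpha> g \<otimes>\<^bsub>AutoGroup H\<^esub> \<alpha> g'"
    using crossed assms unfolding crossed_module_def hom_def by blast
  also have "\<dots> = compose (carrier H) (\<alpha> g) (\<alpha> g')"
    using action_auto assms by (auto simp: AutoGroup_def BijGroup_def auto_def)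
  finally show ?thesis using assms by (simp add: compose_def)
qed

text \<open>The unit of \<open>G\<close> is \<tau> of the unit of \<open>H\<close>, so by the
  Peiffer identity it acts as conjugation by the unit.\<close>

lemma one_action [simp]: "h \<in> carrier H \<Longrightarrow> \<alpha> \<one>\<^bsub>G\<^esub> h = h"
  using peiffer[of "\<one>\<^bsub>H\<^esub>" h] by simp

lemma action_one [simp]: "g \<in> carrier G \<Longrightarrow> \<alpha> g \<one>\<^bsub>H\<^esub> = \<one>\<^bsub>H\<^esub>"
  using action_mult[of g "\<one>\<^bsub>H\<^esub>" "\<one>\<^bsub>H\<^esub>"] by (metis H.l_cancel_one H.one_closed H.r_one action_closed)

section \<open>The semidirect product and its category\<close>

lemma group_semidirect: "group (semidirect H G \<alpha>)"
proof (rule groupI)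
  fix x assume "x \<in> carrier (semidirect H G \<alpha>)"
  then obtain h g where x: "x = (h, g)" "h \<in> carrier H" "g \<in> carrier G"
    by (auto simp: semidirect_def)
  \<comment> \<open>A left inverse must have second component g^-1; its first component k then has
    to satisfy k \<alpha>_{g^-1}(h) = 1.\<close>
  let ?y = "(\<alpha> (inv\<^bsub>G\<^esub> g) (inv\<^bsub>H\<^esub> h), inv\<^bsub>G\<^esub> g)"
  have "?y \<otimes>\<^bsub>semidirect H G \<alpha>\<^esub> x = \<one>\<^bsub>semidirect H G \<alpha>\<^esub>"
    using x by (simp add: semidirect_def flip: action_mult)
  moreover have "?y \<in> carrier (semidirect H G \<alpha>)"
    using x by (simp add: semidirect_def)
  ultimately show "\<exists>y\<in>carrier (semidirect H G \<alpha>). y \<otimes>\<^bsub>semidirect H G \<alpha>\<^esub> x = \<one>\<^bsub>semidirect H G \<alpha>\<^esub>"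
    by blast
qed (auto simp: semidirect_def H.m_assoc G.m_assoc)

lemma semidirect_inv:
  assumes "h \<in> carrier H" "g \<in> carrier G"
  shows "inv\<^bsub>semidirect H G \<alpha>\<^esub> (h, g) = (\<alpha> (inv\<^bsub>G\<^esub> g) (inv\<^bsub>H\<^esub> h), inv\<^bsub>G\<^esub> g)"
  by (rule group.inv_equality[OF group_semidirect])
    (use assms in \<open>simp_all add: semidirect_def flip: action_mult\<close>)

lemma assoc_is_identity:
  assumes "g \<in> carrier G"
  shows "is_identity (assoc_category G H \<alpha> \<tau>) g (\<one>\<^bsub>H\<^esub>, g)"
  using assms by (auto simp: is_identity_def assoc_category_def semidirect_def)

lemma small_assoc_category: "small_category (assoc_category G H \<alpha> \<tau>)"
  unfolding small_category_def
proof (intro conjI ballI impI)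
  fix a assume "a \<in> Obj (assoc_category G H \<alpha> \<tau>)"
  then show "\<exists>i. is_identity (assoc_category G H \<alpha> \<tau>) a i"
    using assoc_is_identity by (auto simp: assoc_category_def)
qed (auto simp: assoc_category_def semidirect_def H.m_assoc G.m_assoc)

text \<open>The exchange law is the Peiffer identity in the form
  \<open>\<alpha> (\<tau> h) k \<otimes> h = h \<otimes> k\<close>.\<close>

lemma assoc_tensor_functor:
  "is_functor (prod_category (assoc_category G H \<alpha> \<tau>) (assoc_category G H \<alpha> \<tau>))
     (assoc_category G H \<alpha> \<tau>)
     (\<lambda>(a, b). a \<otimes>\<^bsub>G\<^esub> b) (\<lambda>(f, g). f \<otimes>\<^bsub>semidirect H G \<alpha>\<^esub> g)" (is "is_functor (prod_category ?K ?K) _ _ _")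
  unfolding is_functor_def
proof (intro conjI ballI impI allI)
  show "small_category (prod_category ?K ?K)" "small_category ?K"
    using small_category_prod small_assoc_category by blast+
next
  fix p assume "p \<in> Obj (prod_category ?K ?K)"
  then show "(case p of (a, b) \<Rightarrow> a \<otimes>\<^bsub>G\<^esub> b) \<in> Obj ?K"
    by (auto simp: prod_category_def assoc_category_def)
next
  fix p assume p: "p \<in> Mor (prod_category ?K ?K)"
  then obtain h g h' g' where p': "p = ((h, g), (h', g'))"
    and mem: "h \<in> carrier H" "g \<in> carrier G" "h' \<in> carrier H" "g' \<in> carrier G"
    by (auto simp: prod_category_def assoc_category_def semidirect_def)
  show "(case p of (f, g) \<Rightarrow> f \<otimes>\<^bsub>semidirect H G \<alpha>\<^esub> g) \<in> Mor ?K"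
    and "Src ?K (case p of (f, g) \<Rightarrow> f \<otimes>\<^bsub>semidirect H G \<alpha>\<^esub> g) = (case Src (prod_category ?K ?K) p of (a, b) \<Rightarrow> a \<otimes>\<^bsub>G\<^esub> b)"
    using mem by (simp_all add: p' prod_category_def assoc_category_def semidirect_def)
  \<comment> \<open>Equivariance replaces \<tau>(\<alpha>_g(h')) by g \<tau>(h') g^-1, and the
    trailing g^-1 cancels against the following g.\<close>
  have "\<tau> (h \<otimes>\<^bsub>H\<^esub> \<alpha> g h') \<otimes>\<^bsub>G\<^esub> (g \<otimes>\<^bsub>G\<^esub> g') = \<tau> h \<otimes>\<^bsub>G\<^esub> g \<otimes>\<^bsub>G\<^esub> (\<tau> h' \<otimes>\<^bsub>G\<^esub> g')"
    using mem by (simp add: equivariant G.m_assoc) (simp flip: G.m_assoc)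
  then show "Tgt ?K (case p of (f, g) \<Rightarrow> f \<otimes>\<^bsub>semidirect H G \<alpha>\<^esub> g) = (case Tgt (prod_category ?K ?K) p of (a, b) \<Rightarrow> a \<otimes>\<^bsub>G\<^esub> b)"
    by (simp add: p' prod_category_def assoc_category_def semidirect_def)
next
  fix p q assume pq: "is_identity (prod_category ?K ?K) p q"
  obtain a b i j where p: "p = (a, b)" and q: "q = (i, j)" by (metis surj_pair)
  have ab: "a \<in> carrier G" "b \<in> carrier G"
    using pq p by (auto simp: is_identity_def prod_category_def assoc_category_def)
  \<comment> \<open>Both components of an identity in the product are identities, hence by
    uniqueness the explicit ones.\<close>
  then have "i = (\<one>\<^bsub>H\<^esub>, a)" "j = (\<one>\<^bsub>H\<^esub>, b)"
    using is_identity_prodD[OF pq[unfolded p q]] is_identity_unique assoc_is_identity by metis+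
  then show "is_identity ?K (case p of (a, b) \<Rightarrow> a \<otimes>\<^bsub>G\<^esub> b) (case q of (f, g) \<Rightarrow> f \<otimes>\<^bsub>semidirect H G \<alpha>\<^esub> g)"
    using ab assoc_is_identity[of "a \<otimes>\<^bsub>G\<^esub> b"] by (simp add: p q semidirect_def)
next
  fix p q assume "p \<in> Mor (prod_category ?K ?K)" "q \<in> Mor (prod_category ?K ?K)"
    "Tgt (prod_category ?K ?K) p = Src (prod_category ?K ?K) q"
  then obtain h1 g1 h1' g1' h2 h2' where pq: "p = ((h1, g1), (h1', g1'))"
      "q = ((h2, \<tau> h1 \<otimes>\<^bsub>G\<^esub> g1), (h2', \<tau> h1' \<otimes>\<^bsub>G\<^esub> g1'))"
    and mem: "h1 \<in> carrier H" "g1 \<in> carrier G" "h1' \<in> carrier H" "g1' \<in> carrier G"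
      "h2 \<in> carrier H" "h2' \<in> carrier H"
    by (auto simp: prod_category_def assoc_category_def semidirect_def)
  have "h2 \<otimes>\<^bsub>H\<^esub> h1 \<otimes>\<^bsub>H\<^esub> \<alpha> g1 (h2' \<otimes>\<^bsub>H\<^esub> h1')
      = h2 \<otimes>\<^bsub>H\<^esub> \<alpha> (\<tau> h1 \<otimes>\<^bsub>G\<^esub> g1) h2' \<otimes>\<^bsub>H\<^esub> (h1 \<otimes>\<^bsub>H\<^esub> \<alpha> g1 h1')"
    using mem by (simp add: peiffer H.m_assoc) (simp flip: H.m_assoc)
  then show "(case Comp (prod_category ?K ?K) q p of (f, g) \<Rightarrow> f \<otimes>\<^bsub>semidirect H G \<alpha>\<^esub> g)
      = Comp ?K (case q of (f, g) \<Rightarrow> f \<otimes>\<^bsub>semidirect H G \<alpha>\<^esub> g) (case p of (f, g) \<Rightarrow> f \<otimes>\<^bsub>semidirect H G \<alpha>\<^esub> g)"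
    by (simp add: pq prod_category_def assoc_category_def semidirect_def)
qed

section \<open>Restriction to the image of \<tau>\<close>

lemma subgroup_image: "subgroup (\<tau> ` carrier H) G"
  using \<tau>.subgroup_img_is_subgroup[OF H.subgroup_self] .

text \<open>The axioms restrict to the subgroup \<tau>(H) at once, apart from equivariance: it
  mentions an inverse, and the inverse taken in the subgroup has to be identified with the one in
  \<open>G\<close>.\<close>

lemma crossed_module_image: "crossed_module (tau_obj_group G H \<tau>) H \<alpha> \<tau>"
proof -
  have "inv\<^bsub>tau_obj_group G H \<tau>\<^esub> g = inv\<^bsub>G\<^esub> g" if "g \<in> \<tau> ` carrier H" for g
    unfolding tau_obj_group_def using G.m_inv_consistent[OF subgroup_image that] .
  moreover have "group (tau_obj_group G H \<tau>)"
    unfolding tau_obj_group_def using G.subgroup_imp_group[OF subgroup_image] .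
  ultimately show ?thesis
    using crossed unfolding crossed_module_def
    by (auto simp: hom_def tau_obj_group_def)
qed

text \<open>Morphisms with source in \<tau>(H) are exactly the pairs in H x \<tau>(H), so everything
  proved about categories of crossed modules applies to the subcategory.\<close>

lemma tau_category_eq: "tau_category G H \<alpha> \<tau> = assoc_category (tau_obj_group G H \<tau>) H \<alpha> \<tau>"
  by (auto simp: tau_category_def assoc_category_def semidirect_def tau_obj_group_def)

lemma tau_mor_group_eq: "tau_mor_group G H \<alpha> \<tau> = semidirect H (tau_obj_group G H \<tau>) \<alpha>"
  by (auto simp: tau_mor_group_def semidirect_def tau_obj_group_def)

lemma subcategory_tau: "subcategory (tau_category G H \<alpha> \<tau>) (assoc_category G H \<alpha> \<tau>)"
proof -
  interpret T: crossed_mod "tau_obj_group G H \<tau>" H \<alpha> \<tau>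
    by unfold_locales (rule crossed_module_image)
  let ?S = "tau_category G H \<alpha> \<tau>" and ?K = "assoc_category G H \<alpha> \<tau>"
  have sub: "Obj ?S \<subseteq> Obj ?K" "Mor ?S \<subseteq> Mor ?K"
    by (auto simp: tau_category_def assoc_category_def)
  have eqs: "Src ?S = Src ?K" "Tgt ?S = Tgt ?K" "Comp ?S = Comp ?K"
    by (simp_all add: tau_category_def)
  \<comment> \<open>Being an identity in the subcategory is tested against fewer morphisms, so the
    property does not pass upward formally. Uniqueness forces \<open>i\<close> to be the explicit
    pair, which is an identity in the large category too.\<close>
  have "is_identity ?K a i" if ai: "is_identity ?S a i" for a i
  proof -
    have "a \<in> carrier (tau_obj_group G H \<tau>)" and a: "a \<in> carrier G"
      using ai sub(1) by (auto simp: is_identity_def assoc_category_def tau_category_def tau_obj_group_def)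
    then have "i = (\<one>\<^bsub>H\<^esub>, a)"
      using ai is_identity_unique T.assoc_is_identity unfolding tau_category_eq by metis
    then show ?thesis using assoc_is_identity a by simp
  qed
  moreover have "small_category ?S"
    unfolding tau_category_eq by (rule T.small_assoc_category)
  moreover have "\<forall>f\<in>Mor ?S. Src ?K f \<in> Obj ?K \<and> Tgt ?K f \<in> Obj ?K"
    using small_assoc_category sub unfolding small_category_def by blast
  ultimately show ?thesis
    using sub small_assoc_category unfolding subcategory_def is_functor_def eqs by auto
qed

end


section \<open>The quotient by the image of a second crossed module\<close>

text \<open>\<open>G Mod H\<close> is built from right cosets, while \<open>obj_coset\<close> and
  \<open>mor_coset\<close> are left cosets; this bridges the two.\<close>

lemma (in normal) r_coset_eq_l_coset: "x \<in> carrier G \<Longrightarrow> H #> x = x <# H"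
  using coset_eq by blast

lemma (in normal) l_coset_mult:
  assumes "x \<in> a <# H" "y \<in> b <# H" "a \<in> carrier G" "b \<in> carrier G"
  shows "x \<otimes> y \<in> (a \<otimes> b) <# H"
proof -
  have "x \<otimes> y \<in> (H #> a) <#> (H #> b)"
    using assms by (auto simp: r_coset_eq_l_coset set_mult_def)
  then show ?thesis
    using assms rcos_sum[of a b] by (simp add: r_coset_eq_l_coset)
qed

lemma (in normal) l_coset_hom_Mod: "(\<lambda>a. a <# H) \<in> hom G (G Mod H)"
  using r_coset_hom_Mod unfolding hom_def by (auto simp: Pi_iff r_coset_eq_l_coset)

lemma (in normal) carrier_Mod_l_coset: "carrier (G Mod H) = (\<lambda>a. a <# H) ` carrier G"
  by (auto simp: carrier_FactGroup r_coset_eq_l_coset)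

lemma (in group) mem_l_coset_iff:
  assumes "subgroup H G" "a \<in> carrier G" "b \<in> carrier G"
  shows "b \<in> a <# H \<longleftrightarrow> b <# H = a <# H"
proof
  assume "b <# H = a <# H"
  moreover have "b \<in> b <# H"
    using assms subgroup.one_closed[OF assms(1)] unfolding l_coset_def by force
  ultimately show "b \<in> a <# H" by simp
qed (use l_repr_independence assms in metis)

text \<open>Restricting a crossed module to the image of \<open>\<tau>\<close> yields one with surjective \<open>\<tau>\<close>, where
  every element of the base group acts on \<open>H\<close> by an inner automorphism.\<close>

locale crossed_mod_pair = crossed_mod G H \<alpha> \<tau> + HJ: crossed_mod H J \<alpha>' \<tau>'
  for G :: "('g, 'x) monoid_scheme" and H :: "('h, 'y) monoid_scheme"
    and J :: "('j, 'z) monoid_scheme" and \<alpha> \<tau> \<alpha>' \<tau>' +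
  assumes surj: "\<tau> ` carrier H = carrier G"
begin

section \<open>The normal subgroups N, M and N x M\<close>

abbreviation "N \<equiv> \<tau>' ` carrier J"
abbreviation "M \<equiv> \<tau> ` N"

text \<open>Equivariance of \<tau>' exhibits the conjugate of \<tau>'(j) by x as
  \<tau>'(\<alpha>'_x(j)).\<close>

sublocale N: normal N H
proof (rule H.normal_invI)
  show "subgroup N H" by (rule HJ.subgroup_image)
  fix x h assume "x \<in> carrier H" "h \<in> N"
  then obtain j where j: "j \<in> carrier J" "h = \<tau>' j" by blast
  then have "x \<otimes>\<^bsub>H\<^esub> h \<otimes>\<^bsub>H\<^esub> inv\<^bsub>H\<^esub> x = \<tau>' (\<alpha>' x j)"
    using HJ.equivariant \<open>x \<in> carrier H\<close> by simp
  then show "x \<otimes>\<^bsub>H\<^esub> h \<otimes>\<^bsub>H\<^esub> inv\<^bsub>H\<^esub> x \<in> N"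
    using HJ.action_closed j \<open>x \<in> carrier H\<close> by blast
qed

text \<open>Surjectivity of \<tau> makes the image of the normal subgroup N normal.\<close>

sublocale M: normal M G
  by (rule N.surj_hom_normal_subgroup[OF \<tau>.group_hom_axioms surj])

lemma image_l_coset:
  assumes "h \<in> carrier H" "x \<in> h <#\<^bsub>H\<^esub> N"
  shows "\<tau> x \<in> \<tau> h <#\<^bsub>G\<^esub> M"
  using assms by (auto simp: l_coset_def)

lemma action_image:
  assumes "g \<in> carrier G"
  shows "\<alpha> g ` N = N"
proof -
  have sub: "\<alpha> g ` N \<subseteq> N" if g: "g \<in> carrier G" for g
  proof -
    obtain k where "k \<in> carrier H" "g = \<tau> k" using g surj by blast
    then show ?thesis
      using N.inv_op_closed2 N.subset by (auto simp: peiffer)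
  qed
  show ?thesis
  proof
    \<comment> \<open>The reverse inclusion is the first one applied to the inverse of
      \<open>g\<close>.\<close>
    show "N \<subseteq> \<alpha> g ` N"
    proof
      fix n assume n: "n \<in> N"
      then have "\<alpha> g (\<alpha> (inv\<^bsub>G\<^esub> g) n) = n"
        using assms N.subset mult_action[of g "inv\<^bsub>G\<^esub> g" n] by auto
      moreover have "\<alpha> (inv\<^bsub>G\<^esub> g) n \<in> N"
        using sub[of "inv\<^bsub>G\<^esub> g"] assms n by auto
      ultimately show "n \<in> \<alpha> g ` N" by (metis imageI)
    qed
  qed (rule sub[OF assms])
qed

lemma J_H_eq: "J_H J \<tau> \<tau>' = N \<times> M"
  by (auto simp: J_H_def)

text \<open>In (h, g)(n, m) = (h \<alpha>_g(n), g m) the acting element is the fixed g, so a left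
  coset is visibly a product set. In a right coset the acting element would run through M.\<close>

lemma semidirect_l_coset:
  assumes "h \<in> carrier H" "g \<in> carrier G"
  shows "(h, g) <#\<^bsub>semidirect H G \<alpha>\<^esub> (N \<times> M) = (h <#\<^bsub>H\<^esub> N) \<times> (g <#\<^bsub>G\<^esub> M)"
proof -
  have "(h, g) <#\<^bsub>semidirect H G \<alpha>\<^esub> (N \<times> M) = (h <#\<^bsub>H\<^esub> (\<alpha> g ` N)) \<times> (g <#\<^bsub>G\<^esub> M)"
    by (auto simp: l_coset_def semidirect_def)
  then show ?thesis using action_image assms by simp
qed

lemma normal_semidirect: "N \<times> M \<lhd> semidirect H G \<alpha>"
proof -
  interpret S: group "semidirect H G \<alpha>" by (rule group_semidirect)
  have N: "n \<in> N \<Longrightarrow> n \<in> carrier H" and M: "m \<in> M \<Longrightarrow> m \<in> carrier G" for n m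
    using N.subset M.subset by auto
  have act: "\<alpha> g n \<in> N" if "g \<in> carrier G" "n \<in> N" for g n
    using action_image that by blast
  show ?thesis
  proof (rule S.normal_invI)
    show "subgroup (N \<times> M) (semidirect H G \<alpha>)"
    proof (rule S.subgroupI)
      show "N \<times> M \<subseteq> carrier (semidirect H G \<alpha>)"
        using N M by (auto simp: semidirect_def)
      show "N \<times> M \<noteq> {}" using N.one_closed by auto
    next
      fix a assume "a \<in> N \<times> M"
      then obtain n m where "a = (n, m)" "n \<in> N" "m \<in> M" by blast
      then show "inv\<^bsub>semidirect H G \<alpha>\<^esub> a \<in> N \<times> M"
        using N M act by (simp add: semidirect_inv N.m_inv_closed M.m_inv_closed)
    next
      fix a b assume "a \<in> N \<times> M" "b \<in> N \<times> M"
      then obtain n m n' m' where "a = (n, m)" "n \<in> N" "m \<in> M" "b = (n', m')" "n' \<in> N" "m' \<in> M"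
        by blast
      then show "a \<otimes>\<^bsub>semidirect H G \<alpha>\<^esub> b \<in> N \<times> M"
        using N M act by (simp add: semidirect_def N.m_closed M.m_closed)
    qed
  next
    fix x a assume "x \<in> carrier (semidirect H G \<alpha>)" "a \<in> N \<times> M"
    then obtain h g n n' where x: "x = (h, g)" "h \<in> carrier H" "g \<in> carrier G"
      and a: "a = (n, \<tau> n')" "n \<in> N" "n' \<in> N"
      by (auto simp: semidirect_def)
    note nH = N[OF a(2)] N[OF a(3)]
    \<comment> \<open>With m = \<tau>(n'), equivariance gives g m g^-1 = \<tau>(k). The second
      component of the conjugate thus lies in M, and it acts on \<open>H\<close> as conjugation by
      k.\<close>
    define k where "k = \<alpha> g n'"
    have k: "k \<in> N" "k \<in> carrier H" unfolding k_def using act N x a by auto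
    have m: "g \<otimes>\<^bsub>G\<^esub> \<tau> n' \<otimes>\<^bsub>G\<^esub> inv\<^bsub>G\<^esub> g = \<tau> k"
      using equivariant x nH by (simp add: k_def)
    have "h \<otimes>\<^bsub>H\<^esub> \<alpha> g n \<otimes>\<^bsub>H\<^esub> \<alpha> (g \<otimes>\<^bsub>G\<^esub> \<tau> n') (\<alpha> (inv\<^bsub>G\<^esub> g) (inv\<^bsub>H\<^esub> h))
        = h \<otimes>\<^bsub>H\<^esub> \<alpha> g n \<otimes>\<^bsub>H\<^esub> \<alpha> (\<tau> k) (inv\<^bsub>H\<^esub> h)"
      using x nH m mult_action[of "g \<otimes>\<^bsub>G\<^esub> \<tau> n'" "inv\<^bsub>G\<^esub> g" "inv\<^bsub>H\<^esub> h"] by simp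
    \<comment> \<open>The Peiffer identity turns the last factor into k h^-1 k^-1; regrouping leaves
      an H-conjugate of an element of N, times k^-1.\<close>
    also have "\<dots> = (h \<otimes>\<^bsub>H\<^esub> (\<alpha> g n \<otimes>\<^bsub>H\<^esub> k) \<otimes>\<^bsub>H\<^esub> inv\<^bsub>H\<^esub> h) \<otimes>\<^bsub>H\<^esub> inv\<^bsub>H\<^esub> k"
      using x nH k by (simp add: peiffer H.m_assoc)
    also have "\<dots> \<in> N"
      using x a k act by (intro N.m_closed N.inv_op_closed2 N.m_inv_closed)
    finally have 1: "h \<otimes>\<^bsub>H\<^esub> \<alpha> g n \<otimes>\<^bsub>H\<^esub> \<alpha> (g \<otimes>\<^bsub>G\<^esub> \<tau> n') (\<alpha> (inv\<^bsub>G\<^esub> g) (inv\<^bsub>H\<^esub> h)) \<in> N" .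
    have "inv\<^bsub>semidirect H G \<alpha>\<^esub> x = (\<alpha> (inv\<^bsub>G\<^esub> g) (inv\<^bsub>H\<^esub> h), inv\<^bsub>G\<^esub> g)"
      using x semidirect_inv by simp
    then have "x \<otimes>\<^bsub>semidirect H G \<alpha>\<^esub> a \<otimes>\<^bsub>semidirect H G \<alpha>\<^esub> inv\<^bsub>semidirect H G \<alpha>\<^esub> x
        = (h \<otimes>\<^bsub>H\<^esub> \<alpha> g n \<otimes>\<^bsub>H\<^esub> \<alpha> (g \<otimes>\<^bsub>G\<^esub> \<tau> n') (\<alpha> (inv\<^bsub>G\<^esub> g) (inv\<^bsub>H\<^esub> h)), \<tau> k)"
      using x a m unfolding semidirect_def by simp
    then show "x \<otimes>\<^bsub>semidirect H G \<alpha>\<^esub> a \<otimes>\<^bsub>semidirect H G \<alpha>\<^esub> inv\<^bsub>semidirect H G \<alpha>\<^esub> x \<in> N \<times> M"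
      using 1 k by auto
  qed
qed

section \<open>The coset maps and the quotient category\<close>

text \<open>Since \<tau> is onto here, restricting to its image changes nothing; this and the
  following equations strip the restriction from all constructions.\<close>

lemma tau_obj_group_surj: "tau_obj_group G H \<tau> = G"
  by (simp add: tau_obj_group_def surj)

lemma tau_mor_group_surj: "tau_mor_group G H \<alpha> \<tau> = semidirect H G \<alpha>"
  by (simp add: tau_mor_group_eq tau_obj_group_surj)

lemma tau_category_surj: "tau_category G H \<alpha> \<tau> = assoc_category G H \<alpha> \<tau>"
  by (simp add: tau_category_eq tau_obj_group_surj)

lemma obj_coset_surj: "obj_coset G H J \<tau> \<tau>' = (\<lambda>g. g <#\<^bsub>G\<^esub> M)"
  by (rule ext) (simp add: obj_coset_def tau_obj_group_surj J_sub_def)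

lemma mor_coset_surj: "mor_coset G H J \<alpha> \<tau> \<tau>' = (\<lambda>f. f <#\<^bsub>semidirect H G \<alpha>\<^esub> (N \<times> M))"
  by (rule ext) (simp add: mor_coset_def tau_mor_group_surj J_H_eq)

lemma mor_coset_pair:
  assumes "h \<in> carrier H" "g \<in> carrier G"
  shows "mor_coset G H J \<alpha> \<tau> \<tau>' (h, g) = (h <#\<^bsub>H\<^esub> N) \<times> obj_coset G H J \<tau> \<tau>' g"
  using assms by (simp add: mor_coset_surj obj_coset_surj semidirect_l_coset)

lemma obj_coset_mem_iff:
  assumes "a \<in> carrier G" "b \<in> carrier G"
  shows "b \<in> obj_coset G H J \<tau> \<tau>' a \<longleftrightarrow> obj_coset G H J \<tau> \<tau>' b = obj_coset G H J \<tau> \<tau>' a"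
  using G.mem_l_coset_iff[OF M.subgroup_axioms] assms by (simp add: obj_coset_surj)

lemma mor_coset_memD:
  assumes "f \<in> mor_coset G H J \<alpha> \<tau> \<tau>' (h, g)" "h \<in> carrier H" "g \<in> carrier G"
  obtains h' g' where "f = (h', g')" "h' \<in> carrier H" "g' \<in> carrier G"
    "h' \<in> h <#\<^bsub>H\<^esub> N" "g' \<in> obj_coset G H J \<tau> \<tau>' g"
proof -
  obtain h' g' where *: "f = (h', g')" "h' \<in> h <#\<^bsub>H\<^esub> N" "g' \<in> obj_coset G H J \<tau> \<tau>' g"
    using assms by (auto simp: mor_coset_pair)
  moreover have "h' \<in> carrier H" "g' \<in> carrier G"
    using * assms H.l_coset_subset_G[OF N.subset] G.l_coset_subset_G[OF M.subset]
    by (auto simp: obj_coset_surj)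
  ultimately show thesis using that by blast
qed

lemma mor_coset_self:
  assumes "h \<in> carrier H" "g \<in> carrier G"
  shows "(h, g) \<in> mor_coset G H J \<alpha> \<tau> \<tau>' (h, g)"
  using assms H.mem_l_coset_iff[OF N.subgroup_axioms] by (simp add: mor_coset_pair obj_coset_mem_iff)

text \<open>Each induced operation is a union of cosets over representatives. It collapses to one
  coset because all members of the family agree and the family is nonempty, the given morphisms
  being representatives of their own cosets.\<close>

sublocale Q: category_quotient "assoc_category G H \<alpha> \<tau>" "quot_category G H J \<alpha> \<tau> \<tau>'"
  "obj_coset G H J \<tau> \<tau>'" "mor_coset G H J \<alpha> \<tau> \<tau>'"
proof
  let ?K = "assoc_category G H \<alpha> \<tau>" and ?L = "quot_category G H J \<alpha> \<tau> \<tau>'"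
  let ?o = "obj_coset G H J \<tau> \<tau>'" and ?m = "mor_coset G H J \<alpha> \<tau> \<tau>'"
  have MorE: thesis if "f \<in> Mor ?K" "\<And>h g. f = (h, g) \<Longrightarrow> h \<in> carrier H \<Longrightarrow> g \<in> carrier G \<Longrightarrow> thesis"
    for f thesis
    using that by (auto simp: assoc_category_def semidirect_def)
  show "small_category ?K" by (rule small_assoc_category)
  show "Obj ?L = ?o ` Obj ?K"
    by (simp add: quot_category_def Let_def quot_obj_group_def tau_obj_group_surj J_sub_def
        M.carrier_Mod_l_coset obj_coset_surj assoc_category_def)
  show "Mor ?L = ?m ` Mor ?K"
    by (simp add: quot_category_def Let_def quot_mor_group_def tau_mor_group_surj J_H_eq
        normal.carrier_Mod_l_coset[OF normal_semidirect] mor_coset_surj assoc_category_def)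
  show "Src ?L (?m f) = ?o (Src ?K f)" if f: "f \<in> Mor ?K" for f
  proof -
    obtain h g where hg: "f = (h, g)" "h \<in> carrier H" "g \<in> carrier G" using MorE[OF f] by blast
    have "?o (Src ?K f') = ?o g" if "f' \<in> ?m f" for f'
      using that hg by (auto elim!: mor_coset_memD simp: obj_coset_mem_iff assoc_category_def)
    then have "Src ?L (?m f) = ?o g"
      using mor_coset_self[OF hg(2,3)] hg(1)
      by (auto simp: quot_category_def Let_def tau_category_surj)
    then show ?thesis by (simp add: hg assoc_category_def)
  qed
  \<comment> \<open>\<tau> maps hN into \<tau>(h)M, and cosets of the normal subgroup M
    multiply.\<close>
  have Tgt_eq: "?o (\<tau> h' \<otimes>\<^bsub>G\<^esub> g') = ?o (\<tau> h \<otimes>\<^bsub>G\<^esub> g)"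
    if "h' \<in> h <#\<^bsub>H\<^esub> N" "g' \<in> ?o g" "h \<in> carrier H" "g \<in> carrier G" "h' \<in> carrier H" "g' \<in> carrier G"
    for h h' g g'
    using M.l_coset_mult[OF image_l_coset, of h h' g' g] that G.mem_l_coset_iff[OF M.subgroup_axioms]
    by (simp add: obj_coset_surj)
  show "Tgt ?L (?m f) = ?o (Tgt ?K f)" if f: "f \<in> Mor ?K" for f
  proof -
    obtain h g where hg: "f = (h, g)" "h \<in> carrier H" "g \<in> carrier G" using MorE[OF f] by blast
    have "?o (Tgt ?K f') = ?o (\<tau> h \<otimes>\<^bsub>G\<^esub> g)" if f': "f' \<in> ?m f" for f'
    proof -
      obtain h' g' where "f' = (h', g')" "h' \<in> carrier H" "g' \<in> carrier G"
        "h' \<in> h <#\<^bsub>H\<^esub> N" "g' \<in> ?o g"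
        using f' hg mor_coset_memD by metis
      then show ?thesis using Tgt_eq hg by (simp add: assoc_category_def)
    qed
    then have "Tgt ?L (?m f) = ?o (\<tau> h \<otimes>\<^bsub>G\<^esub> g)"
      using mor_coset_self[OF hg(2,3)] hg(1)
      by (auto simp: quot_category_def Let_def tau_category_surj)
    then show ?thesis by (simp add: hg assoc_category_def)
  qed
  show "Comp ?L (?m f2) (?m f1) = ?m (Comp ?K f2 f1)"
    if f: "f1 \<in> Mor ?K" "f2 \<in> Mor ?K" "Tgt ?K f1 = Src ?K f2" for f1 f2
  proof -
    obtain h1 g1 where 1: "f1 = (h1, g1)" "h1 \<in> carrier H" "g1 \<in> carrier G" using MorE[OF f(1)] by blast
    obtain h2 g2 where 2: "f2 = (h2, g2)" "h2 \<in> carrier H" "g2 \<in> carrier G" using MorE[OF f(2)] by blast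
    \<comment> \<open>A composite multiplies the first components and keeps the source of the first
      morphism, so its coset depends only on h1 N, h2 N and g1 M.\<close>
    have eq: "?m (Comp ?K f2' f1') = ?m (Comp ?K f2 f1)" if f': "f1' \<in> ?m f1" "f2' \<in> ?m f2" for f1' f2'
    proof -
      obtain h1' g1' where f1: "f1' = (h1', g1')" "h1' \<in> carrier H" "g1' \<in> carrier G"
        "h1' \<in> h1 <#\<^bsub>H\<^esub> N" "g1' \<in> ?o g1"
        using f'(1) 1 mor_coset_memD by metis
      obtain h2' g2' where f2: "f2' = (h2', g2')" "h2' \<in> carrier H" "h2' \<in> h2 <#\<^bsub>H\<^esub> N"
        using f'(2) 2 mor_coset_memD by metis
      have "h2' \<otimes>\<^bsub>H\<^esub> h1' <#\<^bsub>H\<^esub> N = h2 \<otimes>\<^bsub>H\<^esub> h1 <#\<^bsub>H\<^esub> N"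
        using N.l_coset_mult[OF f2(3) f1(4)] H.mem_l_coset_iff[OF N.subgroup_axioms] 1 2 f1 f2 by simp
      moreover have "?o g1' = ?o g1" using 1 f1 obj_coset_mem_iff by simp
      ultimately show ?thesis
        using 1 2 f1 f2 by (simp add: assoc_category_def mor_coset_pair)
    qed
    \<comment> \<open>The family is inhabited by \<open>f1\<close> and \<open>f2\<close> themselves,
      which are composable by assumption.\<close>
    have "{?m (Comp ?K f2' f1') | f1' f2'. f1' \<in> ?m f1 \<and> f2' \<in> ?m f2 \<and> Tgt ?K f1' = Src ?K f2'}
        = {?m (Comp ?K f2 f1)}"
      using eq mor_coset_self 1 2 f(3) by blast
    then show ?thesis
      by (simp add: quot_category_def Let_def tau_category_surj)
  qed
  show "\<exists>g'\<in>Mor ?K. ?m g' = ?m g \<and> Src ?K g' = a"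
    if a: "a \<in> Obj ?K" "g \<in> Mor ?K" "?o a = ?o (Src ?K g)" for a g
  proof -
    obtain h b where g: "g = (h, b)" "h \<in> carrier H" "b \<in> carrier G" using MorE[OF a(2)] by blast
    \<comment> \<open>Keeping the first component and replacing \<open>b\<close> by \<open>a\<close>
      stays in the coset, because \<open>a\<close> and \<open>b\<close> agree modulo M.\<close>
    show ?thesis
      by (rule bexI[of _ "(h, a)"])
        (use g a in \<open>auto simp: assoc_category_def mor_coset_pair semidirect_def\<close>)
  qed
  show "\<exists>f'\<in>Mor ?K. ?m f' = ?m f \<and> Tgt ?K f' = a"
    if a: "a \<in> Obj ?K" "f \<in> Mor ?K" "?o a = ?o (Tgt ?K f)" for a f
  proof -
    obtain h g where f: "f = (h, g)" "h \<in> carrier H" "g \<in> carrier G" using MorE[OF a(2)] by blast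
    have aG: "a \<in> carrier G" using a by (simp add: assoc_category_def)
    \<comment> \<open>With \<open>h\<close> kept, target \<open>a\<close> forces the source
      \<tau>(h)^-1 a. It is congruent to \<open>g\<close> modulo M: translate the congruence of
      \<open>a\<close> and \<tau>(h) g by \<tau>(h)^-1.\<close>
    have "?o (inv\<^bsub>G\<^esub> \<tau> h \<otimes>\<^bsub>G\<^esub> a) = inv\<^bsub>G\<^esub> \<tau> h <#\<^bsub>G\<^esub> ?o a"
      using f aG by (simp add: obj_coset_surj G.lcos_m_assoc[OF M.subset])
    also have "\<dots> = inv\<^bsub>G\<^esub> \<tau> h <#\<^bsub>G\<^esub> ?o (\<tau> h \<otimes>\<^bsub>G\<^esub> g)"
      using a(3) f by (simp add: assoc_category_def)
    also have "\<dots> = ?o g"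
      using f by (simp add: obj_coset_surj G.lcos_m_assoc[OF M.subset] flip: G.m_assoc)
    finally show ?thesis
      using f aG by (intro bexI[of _ "(h, inv\<^bsub>G\<^esub> \<tau> h \<otimes>\<^bsub>G\<^esub> a)"])
        (auto simp: assoc_category_def mor_coset_pair semidirect_def simp flip: G.m_assoc)
  qed
qed

lemma obj_coset_hom: "obj_coset G H J \<tau> \<tau>' \<in> hom G (quot_obj_group G H J \<tau> \<tau>')"
  using M.l_coset_hom_Mod
  by (simp add: obj_coset_surj quot_obj_group_def tau_obj_group_surj J_sub_def)

lemma mor_coset_hom: "mor_coset G H J \<alpha> \<tau> \<tau>' \<in> hom (semidirect H G \<alpha>) (quot_mor_group G H J \<alpha> \<tau> \<tau>')"
  using normal.l_coset_hom_Mod[OF normal_semidirect]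
  by (simp add: mor_coset_surj quot_mor_group_def tau_mor_group_surj J_H_eq)

lemma categorical_group_quotient:
  "categorical_group (quot_category G H J \<alpha> \<tau> \<tau>')
     (quot_obj_group G H J \<tau> \<tau>') (quot_mor_group G H J \<alpha> \<tau> \<tau>')"
proof (rule Q.categorical_group_quot[OF assoc_tensor_functor])
  show "group (quot_obj_group G H J \<tau> \<tau>')"
    using M.factorgroup_is_group by (simp add: quot_obj_group_def tau_obj_group_surj J_sub_def)
  show "group (quot_mor_group G H J \<alpha> \<tau> \<tau>')"
    using normal.factorgroup_is_group[OF normal_semidirect]
    by (simp add: quot_mor_group_def tau_mor_group_surj J_H_eq)
qed (use obj_coset_hom mor_coset_hom in
  \<open>auto simp: quot_category_def Let_def assoc_category_def hom_def\<close>)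

end

section \<open>Return to the given crossed modules\<close>

theorem mainTheorem6:
  fixes G :: "('g, 'e::real_normed_vector) lie_data"
    and H :: "('h, 'f::real_normed_vector) lie_data"
    and J :: "('j, 'k::real_normed_vector) lie_data"
    and \<alpha> :: "'g \<Rightarrow> 'h \<Rightarrow> 'h" and \<tau> :: "'h \<Rightarrow> 'g"
    and \<alpha>' :: "'h \<Rightarrow> 'j \<Rightarrow> 'j" and \<tau>' :: "'j \<Rightarrow> 'h"
  assumes "lie_crossed_module G H \<alpha> \<tau>"
    and "lie_crossed_module H J \<alpha>' \<tau>'"
    and "closedin (Top H) (\<tau>' ` carrier J)"
    and "closedin (Top G) (\<tau> ` \<tau>' ` carrier J)"
  shows "J_sub J \<tau> \<tau>' \<lhd> tau_obj_group G H \<tau>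
    \<and> J_H J \<tau> \<tau>' \<lhd> tau_mor_group G H \<alpha> \<tau>
    \<and> categorical_group (quot_category G H J \<alpha> \<tau> \<tau>')
        (quot_obj_group G H J \<tau> \<tau>') (quot_mor_group G H J \<alpha> \<tau> \<tau>')
    \<and> subcategory (tau_category G H \<alpha> \<tau>) (assoc_category G H \<alpha> \<tau>)
    \<and> is_functor (tau_category G H \<alpha> \<tau>) (quot_category G H J \<alpha> \<tau> \<tau>')
        (obj_coset G H J \<tau> \<tau>') (mor_coset G H J \<alpha> \<tau> \<tau>')
    \<and> obj_coset G H J \<tau> \<tau>' \<in> hom (tau_obj_group G H \<tau>) (quot_obj_group G H J \<tau> \<tau>')
    \<and> mor_coset G H J \<alpha> \<tau> \<tau>' \<in> hom (tau_mor_group G H \<alpha> \<tau>) (quot_mor_group G H J \<alpha> \<tau> \<tau>')"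
proof -
  interpret GH: crossed_mod G H \<alpha> \<tau>
    using assms(1) by unfold_locales (simp add: lie_crossed_module_def)
  \<comment> \<open>Passing from \<open>G\<close> to its subgroup \<tau>(H) makes \<tau> surjective,
    as the pair locale demands.\<close>
  define T where "T = tau_obj_group G H \<tau>"
  interpret T: crossed_mod_pair T H J \<alpha> \<tau> \<alpha>' \<tau>'
  proof
    show "crossed_module T H \<alpha> \<tau>" unfolding T_def by (rule GH.crossed_module_image)
    show "crossed_module H J \<alpha>' \<tau>'" using assms(2) by (simp add: lie_crossed_module_def)
    show "\<tau> ` carrier H = carrier T" by (simp add: T_def tau_obj_group_def)
  qed
  \<comment> \<open>Restricting twice to \<tau>(H) is the same as restricting once. The quotient
    constructions see \<open>G\<close> only through this restriction, so those formed from
    \<open>G\<close> and from \<open>T\<close> coincide.\<close>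
  have obj: "tau_obj_group G H \<tau> = tau_obj_group T H \<tau>"
    by (simp add: T_def tau_obj_group_def)
  have mor: "tau_mor_group G H \<alpha> \<tau> = tau_mor_group T H \<alpha> \<tau>"
    by (simp add: T.tau_mor_group_surj GH.tau_mor_group_eq flip: T_def)
  have cat: "tau_category G H \<alpha> \<tau> = tau_category T H \<alpha> \<tau>"
    by (simp add: T.tau_category_surj GH.tau_category_eq flip: T_def)
  have cosets: "obj_coset G H J \<tau> \<tau>' = obj_coset T H J \<tau> \<tau>'"
    "mor_coset G H J \<alpha> \<tau> \<tau>' = mor_coset T H J \<alpha> \<tau> \<tau>'"
    by (rule ext, simp add: obj_coset_def mor_coset_def obj mor)+
  have quots: "quot_obj_group G H J \<tau> \<tau>' = quot_obj_group T H J \<tau> \<tau>'"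
    "quot_mor_group G H J \<alpha> \<tau> \<tau>' = quot_mor_group T H J \<alpha> \<tau> \<tau>'"
    by (simp_all add: quot_obj_group_def quot_mor_group_def obj mor)
  have quot_cat: "quot_category G H J \<alpha> \<tau> \<tau>' = quot_category T H J \<alpha> \<tau> \<tau>'"
    by (simp add: quot_category_def cat cosets quots)
  have "J_sub J \<tau> \<tau>' \<lhd> T" "J_H J \<tau> \<tau>' \<lhd> semidirect H T \<alpha>"
    using T.M.normal_axioms T.normal_semidirect by (simp_all add: J_sub_def T.J_H_eq)
  then show ?thesis
    using GH.subcategory_tau T.categorical_group_quotient T.Q.is_functor_quot
      T.obj_coset_hom T.mor_coset_hom
    unfolding quot_cat cosets quots
    by (simp add: obj mor cat T.tau_obj_group_surj T.tau_mor_group_surj T.tau_category_surj)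
qed

end
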